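(* Let $n\ge 4$, let $p,q$ be integers with $2\le p<q\le \frac n2$, and let $k_{2q},k_{2p}$ be integers with $1\le k_{2q}<q$ and $1\le k_{2p}<p$. Then in $Alt_n$ the following exchange laws hold: $$v_{2q}^{k_{2q}}\cdot v_{2p}^{k_{2p}}=\begin{cases} v_{2k_{2q}+2k_{2p}}^{k_{2q}}\cdot v_{2p+2k_{2q}}^{k_{2p}}\cdot v_{2q}^{k_{2q}} & \text{if } q-k_{2q}\ge p,\\[4pt] v_{2k_{2q}}^{p+k_{2q}-q}\cdot v_{2k_{2q}+2k_{2p}}^{q-p}\cdot v_{2q}^{k_{2q}+k_{2p}} & \text{if } k_{2p}\le q-k_{2q}\le p,\\[4pt] v_{2p+2k_{2q}-2q}^{k_{2q}+k_{2p}-q}\cdot v_{2k_{2q}}^{p-k_{2p}}\cdot v_{2q}^{k_{2q}+k_{2p}-p} & \text{if } q-k_{2q}\le k_{2p}. \end{cases}$$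
   Context: $S_n$ is the symmetric group on $\{1,\ldots,n\}$ and $Alt_n\le S_n$ is the subgroup of even permutations. Permutations are multiplied left to right: $(\pi_1\cdot\pi_2)(i)=\pi_2(\pi_1(i))$. The cycle $(i_1,i_2,\ldots,i_m)$ sends $i_k\mapsto i_{k+1}$ for $1\le k\le m-1$ and $i_m\mapsto i_1$. Let $s_i=(i,i+1)$ and, for $2\le m\le n$, $t_m=s_1\cdot s_2\cdots s_{m-1}=(m,m-1,\ldots,1)$. For every integer $r$ with $2\le r\le n/2$, $v_{2r}=t_{2r}^2=(2r,2r-2,\ldots,2)(2r-1,2r-3,\ldots,1)$, an element of order $r$ in $Alt_n$. If the index $2$ occurs, $v_2=t_2^2$ is the identity. *)

theory Defs
  imports "HOL-Algebra.Sym_Groups"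
begin

text \<open>
  Permutations are multiplied left to right, whereas \<^const>\<open>sym_group\<close> and \<^const>\<open>alt_group\<close>
  use (\<circ>). So only the multiplication of the library's group is replaced.
\<close>

definition lr_mult :: "(nat \<Rightarrow> nat) \<Rightarrow> (nat \<Rightarrow> nat) \<Rightarrow> (nat \<Rightarrow> nat)" where
  "lr_mult \<pi>\<^sub>1 \<pi>\<^sub>2 = (\<lambda>i. \<pi>\<^sub>2 (\<pi>\<^sub>1 i))"

definition Alt :: "nat \<Rightarrow> (nat \<Rightarrow> nat) monoid" where
  "Alt n = (alt_group n) \<lparr> mult := lr_mult \<rparr>"

definition s :: "nat \<Rightarrow> nat \<Rightarrow> nat" where
  "s i = transpose i (i + 1)"

definition t :: "nat \<Rightarrow> nat \<Rightarrow> nat" where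
  "t m = foldr lr_mult (map s [1..<m]) id"

text \<open>Used only at even \<open>m\<close>; \<open>v m\<close> carries the full index, i.e. \<open>m = 2r\<close> rather than \<open>r\<close>.\<close>

definition v :: "nat \<Rightarrow> nat \<Rightarrow> nat" where
  "v m = lr_mult (t m) (t m)"

lemma lr_mult_assoc: "lr_mult (lr_mult a b) c = lr_mult a (lr_mult b c)"
  by (simp add: lr_mult_def)

lemma lr_mult_id [simp]: "lr_mult id a = a" "lr_mult a id = a"
  by (simp_all add: lr_mult_def)

lemma lr_mult_comp: "lr_mult a b = b \<circ> a"
  by (simp add: lr_mult_def fun_eq_iff)

lemma carrier_Alt: "carrier (Alt n) = {p. p permutes {1..n} \<and> evenperm p}"
  by (auto simp: Alt_def alt_group_def)

lemma mult_Alt: "x \<otimes>\<^bsub>Alt n\<^esub> y = lr_mult x y"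
  by (simp add: Alt_def)

lemma one_Alt: "\<one>\<^bsub>Alt n\<^esub> = id"
  by (simp add: Alt_def alt_group_one)

lemma group_Alt: "group (Alt n)"
proof (rule groupI)
  fix x assume x: "x \<in> carrier (Alt n)"
  have "inv' x \<in> carrier (Alt n)"
    using alt_group_inv_closed[of x n] x by (simp add: Alt_def)
  moreover have "inv' x \<otimes>\<^bsub>Alt n\<^esub> x = \<one>\<^bsub>Alt n\<^esub>"
    using x by (auto simp: mult_Alt one_Alt lr_mult_comp carrier_Alt dest: permutes_inv_o(1))
  ultimately show "\<exists>y\<in>carrier (Alt n). y \<otimes>\<^bsub>Alt n\<^esub> x = \<one>\<^bsub>Alt n\<^esub>"
    by blast
next
  fix x y assume "x \<in> carrier (Alt n)" "y \<in> carrier (Alt n)"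
  then have "x permutes {1..n}" "evenperm x" "y permutes {1..n}" "evenperm y"
    by (simp_all add: carrier_Alt)
  moreover from this have "permutation x" "permutation y"
    using permutation_permutes finite_atLeastAtMost by blast+
  ultimately have "y \<circ> x permutes {1..n}" "evenperm (y \<circ> x)"
    by (simp_all add: permutes_compose evenperm_comp del: One_nat_def)
  then show "x \<otimes>\<^bsub>Alt n\<^esub> y \<in> carrier (Alt n)"
    by (simp add: mult_Alt lr_mult_comp carrier_Alt)
qed (auto simp: mult_Alt one_Alt lr_mult_assoc carrier_Alt permutes_id)

lemma t_Suc: "m \<ge> 1 \<Longrightarrow> t (Suc m) = lr_mult (t m) (s m)"
proof -
  have *: "foldr lr_mult xs a = lr_mult (foldr lr_mult xs id) a" for xs a
    by (induction xs) (simp_all add: lr_mult_assoc lr_mult_def)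
  assume "m \<ge> 1"
  then show ?thesis
    using *[of "map s [1..<m]" "s m"] by (simp add: t_def)
qed

text \<open>That is, \<open>t m\<close> is the cycle \<open>(m, m - 1, \<dots>, 1)\<close>.\<close>

lemma t_apply:
  assumes "m \<ge> 1"
  shows "t m i = (if i = 1 then m else if 2 \<le> i \<and> i \<le> m then i - 1 else i)"
  using assms
proof (induction m rule: dec_induct)
  case base
  then show ?case by (simp add: t_def)
next
  case (step m)
  have "t (Suc m) i = s m (t m i)"
    using t_Suc[of m] step.hyps by (simp add: lr_mult_def)
  then show ?case
    using step.IH step.hyps by (auto simp: s_def transpose_def)
qed

lemma v_2: "v 2 = id"
  by (auto simp: v_def lr_mult_def t_apply fun_eq_iff)

lemma t_permutes:
  assumes "1 \<le> m" "m \<le> n"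
  shows "t m permutes {1..n}"
  using assms
proof (induction m rule: dec_induct)
  case base
  have "t 1 = id" by (simp add: t_def)
  then show ?case by (simp only: permutes_id)
next
  case (step m)
  have "s m permutes {1..n}"
    unfolding s_def using step.hyps step.prems by (intro permutes_swap_id) auto
  moreover have "t m permutes {1..n}" "t (Suc m) = s m \<circ> t m"
    using step t_Suc[of m] by (simp_all add: lr_mult_comp)
  ultimately show ?case
    by (simp only: permutes_compose)
qed

lemma v_in_Alt:
  assumes "1 \<le> m" "m \<le> n"
  shows "v m \<in> carrier (Alt n)"
proof -
  have *: "t m permutes {1..n}"
    using t_permutes assms by blast
  moreover have "permutation (t m)"
    using * permutation_permutes by blast
  ultimately show ?thesis
    by (simp add: carrier_Alt v_def lr_mult_comp permutes_compose evenperm_comp)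
qed

end

theory Submission
  imports Defs
begin

text \<open>
  For \<open>k \<le> r\<close>, the power \<open>v\<^sub>2\<^sub>r\<^sup>k\<close> exchanges the blocks \<open>{1..2k}\<close> and
  \<open>{2k+1..2r}\<close> by translations. In each of the three cases every exponent is at most half the
  index of its generator, so both sides are explicit piecewise translations and can be compared
  pointwise.
\<close>

definition block_swap :: "nat \<Rightarrow> nat \<Rightarrow> nat \<Rightarrow> nat" where
  "block_swap r k i =
    (if 1 \<le> i \<and> i \<le> 2 * k then i + 2 * (r - k)
     else if 2 * k < i \<and> i \<le> 2 * r then i - 2 * k else i)"

lemma block_swap_low: "0 < i \<Longrightarrow> i \<le> 2 * k \<Longrightarrow> block_swap r k i = i + 2 * (r - k)"
  by (simp add: block_swap_def)

lemma block_swap_high: "2 * k < i \<Longrightarrow> i \<le> 2 * r \<Longrightarrow> block_swap r k i = i - 2 * k"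
  by (simp add: block_swap_def)

lemma block_swap_fix: "i = 0 \<or> 2 * k < i \<and> 2 * r < i \<Longrightarrow> block_swap r k i = i"
  by (auto simp: block_swap_def)

text \<open>On the right, the two inner swaps fix \<open>{1..2a}\<close> and exchange the adjacent
  blocks of lengths \<open>2k\<close> and \<open>2(p-k)\<close> behind it. The outer swap carries
  these blocks onto \<open>{1..2p}\<close> and \<open>{1..2a}\<close> above \<open>2p\<close>, so
  this conjugates \<open>block_swap p k\<close>.\<close>

lemma block_swap_comm_disjoint:
  fixes a b k p q :: nat
  assumes "k \<le> p" "p + a \<le> q"
  shows "block_swap p k (block_swap q a i) =
    block_swap q a (block_swap (p + a) k (block_swap (a + k) a i))"
proof -
  \<comment> \<open>Slack variables remove truncated subtraction; on each interval of the case
    split, every swap is a single translation.\<close>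
  obtain c d where [simp]: "p = k + c" "q = k + c + a + d"
    by (rule that[of "p - k" "q - p - a"]) (use assms in simp_all)
  consider "i = 0"
    | "0 < i" "i \<le> 2 * a"
    | "2 * a < i" "i \<le> 2 * (a + k)"
    | "2 * (a + k) < i" "i \<le> 2 * (a + p)"
    | "2 * (a + p) < i" "i \<le> 2 * q"
    | "2 * q < i"
    by linarith
  then show ?thesis
    by cases
      (auto dest!: less_imp_Suc_add simp: block_swap_low block_swap_high block_swap_fix)
qed

text \<open>Points up to \<open>2(p+a-q)\<close> are now carried into \<open>{2k+1..2p}\<close>. The
  two inner swaps exchange the blocks \<open>{2(p+a-q)+1..2a}\<close> and
  \<open>{2a+1..2(a+k)}\<close>, and the outer swap translates all of
  \<open>{1..2(a+k)}\<close>.\<close>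

lemma block_swap_comm_overlap:
  assumes "k \<le> q - a" "q - a \<le> p" "p \<le> q" "a \<le> q"
  shows "block_swap p k (block_swap q a i) =
    block_swap q (a + k) (block_swap (a + k) (q - p) (block_swap a (p + a - q) i))"
proof -
  obtain c e f where [simp]: "q = a + (k + c)" "p = k + c + e" "a = e + f"
    by (rule that[of "q - a - k" "p + a - q" "q - p"]) (use assms in simp_all)
  consider "i = 0"
    | "0 < i" "i \<le> 2 * (p + a - q)"
    | "2 * (p + a - q) < i" "i \<le> 2 * a"
    | "2 * a < i" "i \<le> 2 * (a + k)"
    | "2 * (a + k) < i" "i \<le> 2 * q"
    | "2 * q < i"
    by linarith
  then show ?thesis
    by cases
      (auto dest!: less_imp_Suc_add simp: block_swap_low block_swap_high block_swap_fix)
qed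

text \<open>The boundary \<open>2k\<close> is now at or beyond the lower end of the image of
  \<open>{1..2a}\<close>. The two inner swaps exchange the adjacent blocks of lengths
  \<open>2(p-k)\<close> and \<open>2(q-p)\<close> that fill \<open>{2(a+k-q)+1..2a}\<close>.\<close>

lemma block_swap_comm_wrap:
  assumes "q - a \<le> k" "k \<le> p" "p \<le> q" "a \<le> q"
  shows "block_swap p k (block_swap q a i) =
    block_swap q (a + k - p) (block_swap a (p - k) (block_swap (p + a - q) (a + k - q) i))"
proof -
  obtain d e f g where [simp]: "q = a + d" "k = d + e" "p = d + e + f" "a = e + f + g"
    by (rule that[of "q - a" "a + k - q" "p - k" "q - p"]) (use assms in simp_all)
  consider "i = 0"
    | "0 < i" "i \<le> 2 * (a + k - q)"
    | "2 * (a + k - q) < i" "i \<le> 2 * (p + a - q)"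
    | "2 * (p + a - q) < i" "i \<le> 2 * a"
    | "2 * a < i" "i \<le> 2 * q"
    | "2 * q < i"
    by linarith
  then show ?thesis
    by cases
      (auto dest!: less_imp_Suc_add simp: block_swap_low block_swap_high block_swap_fix)
qed

lemma v_eq_block_swap:
  assumes "1 \<le> r"
  shows "v (2 * r) = block_swap r 1"
  using assms by (auto simp: fun_eq_iff v_def lr_mult_def t_apply block_swap_def)

text \<open>Each further factor sends the values 1 and 2 to the top of \<open>{1..2r}\<close> and
  lowers the others by 2; the bound \<open>k \<le> r\<close> prevents a second wrap.\<close>

lemma v_pow:
  assumes "1 \<le> r" "k \<le> r"
  shows "v (2 * r) [^]\<^bsub>Alt n\<^esub> k = block_swap r k"
  using assms(2)
proof (induction k)
  case 0
  interpret group "Alt n" by (rule group_Alt)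
  show ?case by (auto simp: one_Alt block_swap_def)
next
  case (Suc k)
  interpret group "Alt n" by (rule group_Alt)
  have "v (2 * r) [^]\<^bsub>Alt n\<^esub> Suc k = (\<lambda>i. block_swap r 1 (block_swap r k i))"
    \<comment> \<open>The literal \<open>1\<close> is kept so that \<open>block_swap r 1\<close>
      folds back to \<open>v (2 * r)\<close>.\<close>
    using Suc by (simp add: mult_Alt lr_mult_def v_eq_block_swap[OF assms(1), symmetric] del: One_nat_def)
  also have "\<dots> = block_swap r (Suc k)"
    using Suc.prems by (auto simp: block_swap_def fun_eq_iff)
  finally show ?case .
qed

theorem proposition3p1:
  fixes n p q k\<^sub>q k\<^sub>p :: nat
  assumes "n \<ge> 4"
    and "2 \<le> p" and "p < q" and "2 * q \<le> n"
    and "1 \<le> k\<^sub>q" and "k\<^sub>q < q"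
    and "1 \<le> k\<^sub>p" and "k\<^sub>p < p"
  shows "(p \<le> q - k\<^sub>q \<longrightarrow>
           v (2*q) [^]\<^bsub>Alt n\<^esub> k\<^sub>q \<otimes>\<^bsub>Alt n\<^esub> v (2*p) [^]\<^bsub>Alt n\<^esub> k\<^sub>p =
           v (2*k\<^sub>q + 2*k\<^sub>p) [^]\<^bsub>Alt n\<^esub> k\<^sub>q
             \<otimes>\<^bsub>Alt n\<^esub> v (2*p + 2*k\<^sub>q) [^]\<^bsub>Alt n\<^esub> k\<^sub>p
             \<otimes>\<^bsub>Alt n\<^esub> v (2*q) [^]\<^bsub>Alt n\<^esub> k\<^sub>q)
       \<and> (k\<^sub>p \<le> q - k\<^sub>q \<and> q - k\<^sub>q \<le> p \<longrightarrow>
           v (2*q) [^]\<^bsub>Alt n\<^esub> k\<^sub>q \<otimes>\<^bsub>Alt n\<^esub> v (2*p) [^]\<^bsub>Alt n\<^esub> k\<^sub>p =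
           v (2*k\<^sub>q) [^]\<^bsub>Alt n\<^esub> (p + k\<^sub>q - q)
             \<otimes>\<^bsub>Alt n\<^esub> v (2*k\<^sub>q + 2*k\<^sub>p) [^]\<^bsub>Alt n\<^esub> (q - p)
             \<otimes>\<^bsub>Alt n\<^esub> v (2*q) [^]\<^bsub>Alt n\<^esub> (k\<^sub>q + k\<^sub>p))
       \<and> (q - k\<^sub>q \<le> k\<^sub>p \<longrightarrow>
           v (2*q) [^]\<^bsub>Alt n\<^esub> k\<^sub>q \<otimes>\<^bsub>Alt n\<^esub> v (2*p) [^]\<^bsub>Alt n\<^esub> k\<^sub>p =
           v (2*p + 2*k\<^sub>q - 2*q) [^]\<^bsub>Alt n\<^esub> (k\<^sub>q + k\<^sub>p - q)
             \<otimes>\<^bsub>Alt n\<^esub> v (2*k\<^sub>q) [^]\<^bsub>Alt n\<^esub> (p - k\<^sub>p)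
             \<otimes>\<^bsub>Alt n\<^esub> v (2*q) [^]\<^bsub>Alt n\<^esub> (k\<^sub>q + k\<^sub>p - p))"
proof -
  \<comment> \<open>A separate \<open>m\<close> lets indices be written as sums or differences, as
    in the exchange laws.\<close>
  have pow: "v m [^]\<^bsub>Alt n\<^esub> k = block_swap r k" if "m = 2 * r" "1 \<le> r" "k \<le> r" for m r k
    using that v_pow by simp
  have q: "v (2*q) [^]\<^bsub>Alt n\<^esub> k = block_swap q k" if "k \<le> q" for k
    using that assms by (intro pow) auto
  have p: "v (2*p) [^]\<^bsub>Alt n\<^esub> k\<^sub>p = block_swap p k\<^sub>p"
    using assms by (intro pow) auto
  have kq: "v (2*k\<^sub>q) [^]\<^bsub>Alt n\<^esub> k = block_swap k\<^sub>q k" if "k \<le> k\<^sub>q" for k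
    using that assms by (intro pow) auto
  have kqp: "v (2*k\<^sub>q + 2*k\<^sub>p) [^]\<^bsub>Alt n\<^esub> k = block_swap (k\<^sub>q + k\<^sub>p) k" if "k \<le> k\<^sub>q + k\<^sub>p" for k
    using that assms by (intro pow) auto
  have pkq: "v (2*p + 2*k\<^sub>q) [^]\<^bsub>Alt n\<^esub> k\<^sub>p = block_swap (p + k\<^sub>q) k\<^sub>p"
    using assms by (intro pow) auto
  \<comment> \<open>The index is positive because
    \<open>q - k\<^sub>q \<le> k\<^sub>p < p\<close>.\<close>
  have last: "v (2*p + 2*k\<^sub>q - 2*q) [^]\<^bsub>Alt n\<^esub> (k\<^sub>q + k\<^sub>p - q) =
      block_swap (p + k\<^sub>q - q) (k\<^sub>q + k\<^sub>p - q)"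
    if "q - k\<^sub>q \<le> k\<^sub>p"
    using that assms by (intro pow) auto
  \<comment> \<open>These bounds discharge the side conditions of \<open>q\<close> and
    \<open>kqp\<close> in the middle case.\<close>
  have exps: "k\<^sub>q + k\<^sub>p \<le> q" "q - p \<le> k\<^sub>q + k\<^sub>p" if "k\<^sub>p \<le> q - k\<^sub>q \<and> q - k\<^sub>q \<le> p"
    using that assms by auto
  show ?thesis
    using assms
    by (intro conjI impI) (simp_all add: mult_Alt lr_mult_def q p kq kqp pkq last exps block_swap_comm_disjoint
        block_swap_comm_overlap block_swap_comm_wrap)
qed

end
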